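(* Let $r\ge 1$ be an integer and suppose that $A\subseteq\mathbb{F}_2^r$ is round. If $|A|>\frac13\,2^r+2$, then there are a sum-free set $S\subseteq\mathbb{F}_2^r$ and an element $g\in\mathbb{F}_2^r$ such that $A=g+(S\cup\{0\})$.
   Context: $\mathbb{F}_2^r$ denotes the elementary abelian $2$-group of rank $r$. For $X\subseteq\mathbb{F}_2^r$, $2X:=\{x_1+x_2\colon x_1,x_2\in X\}$ (with $x_1=x_2$ allowed), and $g+X:=\{g+x\colon x\in X\}$. A set $A\subseteq\mathbb{F}_2^r$ is round if $2B\ne 2A$ for every proper subset $B\subsetneq A$. A set $S$ is sum-free if $S\cap 2S=\varnothing$. *)

theory Defs
  imports
    "HOL-Library.Z2"
    "HOL-Library.Set_Algebras"
    "HOL-Analysis.Finite_Cartesian_Product"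
begin

text \<open>
  The group \<open>F\<^sub>2\<^sup>r\<close> is rendered as \<^typ>\<open>bit ^ 'n\<close>, with \<open>r = CARD('n)\<close>. The operations
  \<open>X + X\<close> and \<open>g +o X\<close> on sets are the Minkowski sum and the translate.
\<close>

definition round_set :: "'a::plus set \<Rightarrow> bool"
  where "round_set A \<longleftrightarrow> (\<forall>B. B \<subset> A \<longrightarrow> B + B \<noteq> A + A)"

definition sum_free :: "'a::plus set \<Rightarrow> bool"
  where "sum_free S \<longleftrightarrow> S \<inter> (S + S) = {}"

end

theory Submission
  imports Defs
begin

text \<open>
  Join two distinct points of \<open>A\<close> by an edge if their sum has no other representation in
  \<open>A + A\<close>; roundness means that no vertex is isolated, and the conclusion says that some vertex
  \<open>g\<close> is joined to all others. As a graph without isolated vertices and without two disjoint edges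
  is a star or a triangle, it suffices to exclude disjoint edges.

  Let \<open>N\<close> be the order of the group and assume that \<open>3|A| > N + 6\<close>. For the sum \<open>d\<close> of an edge, the
  sets \<open>A\<close> and \<open>d + A\<close> share just two points. As \<open>A\<close>, \<open>d + A\<close>, \<open>d' + A\<close> cannot be nearly
  disjoint, the set of all edge sums is sum-free. For an edge \<open>ab\<close> with sum \<open>d\<close>, the complement
  \<open>V\<close> of \<open>(a + A) \<union> (b + A)\<close> has size \<open>N - 2|A| + 2\<close>, is invariant under translation by \<open>d\<close>, and
  contains the set \<open>D\<close> of the sums over all edges missing \<open>a\<close> and \<open>b\<close>. As \<open>D\<close> and \<open>d + D\<close> are
  disjoint, \<open>2|D| \<le> |V|\<close>, so that few edges miss \<open>ab\<close>. On the other hand, since every degree is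
  positive, two disjoint edges are on average missed by many edges; together, \<open>3|A| \<le> N + 6\<close>,
  a contradiction.
\<close>

lemma card_le_mult_card_image:
  assumes "finite A" "\<And>y. y \<in> f ` A \<Longrightarrow> card {x \<in> A. f x = y} \<le> k"
  shows "card A \<le> k * card (f ` A)"
proof -
  have "card A = (\<Sum>y\<in>f ` A. card {x \<in> A. f x = y})"
    using sum.image_gen[OF assms(1), of "\<lambda>_. 1::nat" f] by simp
  also have "\<dots> \<le> k * card (f ` A)"
    using sum_bounded_above[OF assms(2)] by (simp add: mult.commute)
  finally show ?thesis .
qed

lemma card_plus_card_plus_card_le:
  assumes "finite A" "finite B" "finite C"
  shows "card A + card B + card C
    \<le> card (A \<union> B \<union> C) + card (A \<inter> B) + card (A \<inter> C) + card (B \<inter> C)"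
proof -
  have "card A + card B = card (A \<union> B) + card (A \<inter> B)"
    using assms by (intro card_Un_Int)
  moreover have "card (A \<union> B) + card C = card (A \<union> B \<union> C) + card ((A \<union> B) \<inter> C)"
    using assms by (intro card_Un_Int) auto
  moreover have "card ((A \<union> B) \<inter> C) \<le> card (A \<inter> C) + card (B \<inter> C)"
    unfolding Int_Un_distrib2 by (rule card_Un_le)
  ultimately show ?thesis
    by linarith
qed


subsection \<open>Symmetric relations as graphs\<close>

lemma ex_dominating_vertex:
  assumes "sym E" "E \<noteq> {}"
    and meet: "\<And>a b c d. (a, b) \<in> E \<Longrightarrow> (c, d) \<in> E \<Longrightarrow> {a, b} \<inter> {c, d} \<noteq> {}"
  shows "\<exists>g\<in>Domain E. Domain E - {g} \<subseteq> E `` {g}"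
proof -
  note commute = symD[OF \<open>sym E\<close>]
  obtain a b where ab: "(a, b) \<in> E"
    using \<open>E \<noteq> {}\<close> by auto
  show ?thesis
  proof (cases "Domain E - {a} \<subseteq> E `` {a}")
    case True
    with ab show ?thesis
      by blast
  next
    case False
    then obtain x where "x \<in> Domain E" and x: "x \<noteq> a" "(a, x) \<notin> E"
      by blast
    then obtain y where "(x, y) \<in> E"
      by blast
    with meet[OF ab] x ab commute have xb: "(x, b) \<in> E"
      by blast
    have "(b, z) \<in> E" if "z \<in> Domain E" "z \<noteq> b" for z
    proof (rule ccontr)
      assume bz: "(b, z) \<notin> E"
      obtain w where "(z, w) \<in> E"
        using \<open>z \<in> Domain E\<close> by blast
      with meet[OF ab] \<open>z \<noteq> b\<close> bz ab commute have "(z, a) \<in> E"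
        by blast
      with meet[OF xb] \<open>z \<noteq> b\<close> x xb commute show False
        by blast
    qed
    with commute[OF ab] show ?thesis
      by blast
  qed
qed

definition degree :: "'a rel \<Rightarrow> 'a \<Rightarrow> nat"
  where "degree E x = card (E `` {x})"

lemma sum_degree_plus_card_Domain_le:
  assumes "finite E" "P \<subseteq> Domain E"
  shows "sum (degree E) P + card (Domain E) \<le> card E + card P"
proof -
  have fin: "finite (Domain E)" "finite P"
    using assms finite_Domain finite_subset by blast+
  have "E = Sigma (Domain E) (\<lambda>x. E `` {x})"
    by auto
  then have "card E = sum (degree E) (Domain E)"
    using assms(1) fin(1) by (simp add: degree_def flip: card_SigmaI)
  also have "\<dots> = sum (degree E) (Domain E - P) + sum (degree E) P"
    using fin(1) assms(2) by (rule sum.subset_diff[rotated])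
  finally have "card E = sum (degree E) (Domain E - P) + sum (degree E) P" .
  moreover have "card (Domain E - P) \<le> sum (degree E) (Domain E - P)"
  proof -
    have "1 \<le> degree E x" if "x \<in> Domain E" for x
      using that assms(1) by (auto simp: degree_def Suc_le_eq card_gt_0_iff)
    then show ?thesis
      using sum_mono[of "Domain E - P" "\<lambda>_. 1" "degree E"] by simp
  qed
  moreover have "card (Domain E - P) + card P = card (Domain E)"
    using assms(2) fin by (simp add: card_Diff_subset card_mono)
  ultimately show ?thesis
    by linarith
qed

lemma card_le_card_Restr_plus_sum_degree:
  assumes "finite E" "sym E" "finite P"
  shows "card E \<le> card (Restr E (- P)) + 2 * sum (degree E) P"
proof -
  define F where "F = Sigma P (\<lambda>x. E `` {x})"
  have "E \<subseteq> Restr E (- P) \<union> (F \<union> F\<inverse>)"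
    using symD[OF \<open>sym E\<close>] by (auto simp: F_def)
  moreover have "finite F"
    using assms by (simp add: F_def)
  ultimately have "card E \<le> card (Restr E (- P) \<union> (F \<union> F\<inverse>))"
    using \<open>finite E\<close> by (intro card_mono) auto
  also have "\<dots> \<le> card (Restr E (- P)) + (card F + card (F\<inverse>))"
    by (meson card_Un_le add_left_mono order_trans)
  also have "\<dots> = card (Restr E (- P)) + 2 * sum (degree E) P"
    using assms by (simp add: F_def degree_def)
  finally show ?thesis .
qed

lemma card_Domain_le_card_Restr:
  assumes "finite E" "sym E" "P \<subseteq> Domain E" "Q \<subseteq> Domain E" "P \<inter> Q = {}"
  shows "2 * card (Domain E)
    \<le> card (Restr E (- P)) + card (Restr E (- Q)) + 2 * card P + 2 * card Q"
proof -
  have fin: "finite P" "finite Q"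
    using assms finite_Domain finite_subset by blast+
  have "sum (degree E) P + sum (degree E) Q + card (Domain E) \<le> card E + (card P + card Q)"
    using sum_degree_plus_card_Domain_le[of E "P \<union> Q"] assms fin
    by (simp add: sum.union_disjoint card_Un_disjoint)
  moreover have "card E \<le> card (Restr E (- P)) + 2 * sum (degree E) P"
    using assms(1,2) fin(1) by (rule card_le_card_Restr_plus_sum_degree)
  moreover have "card E \<le> card (Restr E (- Q)) + 2 * sum (degree E) Q"
    using assms(1,2) fin(2) by (rule card_le_card_Restr_plus_sum_degree)
  ultimately show ?thesis
    by linarith
qed


subsection \<open>Groups of exponent two\<close>

class boolean_group = ab_group_add +
  assumes add_self [simp]: "x + x = 0"
begin

lemma add_self_left [simp]: "x + (x + y) = y"
  by (simp flip: add_assoc)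

lemma diff_eq_add: "x - y = x + y"
  by (metis add_0_right add_assoc add_self diff_eq_eq)

end

lemma mem_translate_iff: "x \<in> a +o A \<longleftrightarrow> a + x \<in> A" for a :: "'a::boolean_group"
  by (metis add.commute diff_eq_add set_minus_plus)

lemma card_translate [simp]: "card (a +o A) = card A" for a :: "'a::cancel_semigroup_add"
proof -
  have "a +o A = (+) a ` A"
    by (auto simp: elt_set_plus_def)
  then show ?thesis
    by (simp add: card_image)
qed


subsection \<open>The graph of uniquely represented sums\<close>

definition unique_sum_graph :: "'a::plus set \<Rightarrow> 'a rel"
  where "unique_sum_graph A = {(a, b). a \<in> A \<and> b \<in> A \<and> a \<noteq> b \<and>
    (\<forall>x\<in>A. \<forall>y\<in>A. x + y = a + b \<longrightarrow> {x, y} = {a, b})}"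

definition edge_sums :: "'a::plus rel \<Rightarrow> 'a set"
  where "edge_sums E = (\<lambda>(x, y). x + y) ` E"

abbreviation unique_sums :: "'a::plus set \<Rightarrow> 'a set"
  where "unique_sums A \<equiv> edge_sums (unique_sum_graph A)"

lemma edge_sumsI: "(x, y) \<in> E \<Longrightarrow> x + y \<in> edge_sums E"
  by (force simp: edge_sums_def)

lemma edge_sumsE:
  assumes "s \<in> edge_sums E"
  obtains x y where "(x, y) \<in> E" "s = x + y"
  using assms by (auto simp: edge_sums_def)

lemma unique_sum_graphD:
  assumes "(a, b) \<in> unique_sum_graph A"
  shows "a \<in> A" "b \<in> A" "a \<noteq> b"
    "\<And>x y. x \<in> A \<Longrightarrow> y \<in> A \<Longrightarrow> x + y = a + b \<Longrightarrow> {x, y} = {a, b}"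
  using assms unfolding unique_sum_graph_def by blast+

lemma sym_unique_sum_graph: "sym (unique_sum_graph (A :: 'a::ab_semigroup_add set))"
  by (rule symI) (simp add: unique_sum_graph_def, metis add.commute insert_commute)

lemma card_le_two_card_edge_sums:
  assumes "finite F" "F \<subseteq> unique_sum_graph A"
  shows "card F \<le> 2 * card (edge_sums F)"
  unfolding edge_sums_def
proof (rule card_le_mult_card_image[OF \<open>finite F\<close>])
  fix s
  assume "s \<in> (\<lambda>(x, y). x + y) ` F"
  then obtain a b where ab: "(a, b) \<in> unique_sum_graph A" "s = a + b"
    using assms(2) by auto
  have "{p \<in> F. (\<lambda>(x, y). x + y) p = s} \<subseteq> {(a, b), (b, a)}"
  proof (rule subrelI)
    fix x y
    assume "(x, y) \<in> {p \<in> F. (\<lambda>(x, y). x + y) p = s}"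
    then have xy: "(x, y) \<in> unique_sum_graph A" "x + y = a + b"
      using assms(2) ab(2) by auto
    have "{x, y} = {a, b}"
      using unique_sum_graphD(1,2)[OF xy(1)] xy(2) by (rule unique_sum_graphD(4)[OF ab(1)])
    then show "(x, y) \<in> {(a, b), (b, a)}"
      by (auto simp: doubleton_eq_iff)
  qed
  then have "card {p \<in> F. (\<lambda>(x, y). x + y) p = s} \<le> card {(a, b), (b, a)}"
    by (intro card_mono) simp_all
  also have "\<dots> = 2"
    using unique_sum_graphD(3)[OF ab(1)] by simp
  finally show "card {p \<in> F. (\<lambda>(x, y). x + y) p = s} \<le> 2" .
qed

lemma unique_sum_notin_translate:
  assumes "(x, y) \<in> unique_sum_graph A" "a \<in> A" "a \<notin> {x, y}"
  shows "x + y \<notin> a +o A"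
proof
  assume "x + y \<in> a +o A"
  then obtain z where "z \<in> A" "a + z = x + y"
    by (auto simp: elt_set_plus_def)
  with assms unique_sum_graphD(4) show False
    by blast
qed

lemma card_Int_translates:
  fixes A :: "'a::boolean_group set"
  assumes "a + b \<in> unique_sums A"
  shows "card ((a +o A) \<inter> (b +o A)) = 2"
proof -
  obtain x y where xy: "(x, y) \<in> unique_sum_graph A" "a + b = x + y"
    using assms by (rule edge_sumsE)
  have "(a +o A) \<inter> (b +o A) = {a + x, a + y}"
  proof
    show "(a +o A) \<inter> (b +o A) \<subseteq> {a + x, a + y}"
    proof
      fix z
      assume "z \<in> (a +o A) \<inter> (b +o A)"
      then have "a + z \<in> A" "b + z \<in> A"
        by (simp_all add: mem_translate_iff)
      moreover have "(a + z) + (b + z) = x + y"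
        by (simp add: ac_simps flip: xy(2))
      ultimately have "{a + z, b + z} = {x, y}"
        by (rule unique_sum_graphD(4)[OF xy(1)])
      then have "a + z = x \<or> a + z = y"
        by blast
      then show "z \<in> {a + x, a + y}"
        by auto
    qed
    have "b + (a + x) = y" "b + (a + y) = x"
      using xy(2) by (simp_all add: ac_simps flip: add.assoc)
    then show "{a + x, a + y} \<subseteq> (a +o A) \<inter> (b +o A)"
      using unique_sum_graphD(1,2)[OF xy(1)] by (simp add: mem_translate_iff)
  qed
  then show ?thesis
    using unique_sum_graphD(3)[OF xy(1)] by simp
qed


subsection \<open>Large round sets\<close>

lemma sum_freeI:
  assumes "\<And>x y. x \<in> S \<Longrightarrow> y \<in> S \<Longrightarrow> x + y \<notin> S"
  shows "sum_free S"
  using assms by (auto simp: sum_free_def elim!: set_plus_elim)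

lemma sum_free_unique_sums:
  fixes A :: "'a::{boolean_group, finite} set"
  assumes large: "3 * card A > CARD('a) + 6"
  shows "sum_free (unique_sums A)"
proof (rule sum_freeI, rule notI)
  fix d d'
  assume "d \<in> unique_sums A" "d' \<in> unique_sums A" and "d + d' \<in> unique_sums A"
  then have "card (A \<inter> (d +o A)) = 2" "card (A \<inter> (d' +o A)) = 2"
    and "card ((d +o A) \<inter> (d' +o A)) = 2"
    using card_Int_translates[of 0 _ A] card_Int_translates[of d d' A] by simp_all
  moreover have "card (A \<union> (d +o A) \<union> (d' +o A)) \<le> CARD('a)"
    by (simp add: card_mono)
  ultimately show False
    using card_plus_card_plus_card_le[of A "d +o A" "d' +o A"] large by simp
qed

lemma card_edge_sums_missing_edge:
  fixes A :: "'a::{boolean_group, finite} set"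
  assumes sum_free: "sum_free (unique_sums A)"
    and ab: "(a, b) \<in> unique_sum_graph A"
  shows "2 * card (edge_sums (Restr (unique_sum_graph A) (- {a, b}))) + 2 * card A
    \<le> CARD('a) + 2"
proof -
  define D where "D = edge_sums (Restr (unique_sum_graph A) (- {a, b}))"
  define U where "U = (a +o A) \<union> (b +o A)"
  have d: "a + b \<in> unique_sums A"
    using ab by (rule edge_sumsI)
  have "D \<inter> ((a + b) +o D) = {}"
  proof -
    have "D \<subseteq> unique_sums A"
      by (auto simp: D_def edge_sums_def)
    then have "(a + b) +o D \<subseteq> unique_sums A + unique_sums A"
      by (rule set_plus_mono5[OF d])
    with \<open>D \<subseteq> unique_sums A\<close> sum_free show ?thesis
      by (auto simp: sum_free_def)
  qed
  then have "2 * card D = card (D \<union> ((a + b) +o D))"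
    by (simp add: card_Un_disjoint)
  moreover have "D \<union> ((a + b) +o D) \<subseteq> - U"
  proof -
    have "D \<inter> U = {}"
      using unique_sum_graphD(1,2)[OF ab]
      by (auto simp: D_def U_def elim!: edge_sumsE dest: unique_sum_notin_translate)
    moreover have "(a + b) + x \<in> U \<longleftrightarrow> x \<in> U" for x
      by (auto simp: U_def mem_translate_iff ac_simps)
    ultimately show ?thesis
      by (auto simp: mem_translate_iff)
  qed
  then have "card (D \<union> ((a + b) +o D)) + card U \<le> CARD('a)"
    by (subst card_Un_disjoint[symmetric]) (auto intro: card_mono)
  moreover have "card U + 2 = 2 * card A"
    using card_Un_Int[of "a +o A" "b +o A"] card_Int_translates[OF d] by (simp add: U_def)
  ultimately show ?thesis
    by (simp add: D_def)
qed

lemma card_le_if_disjoint_edges: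
  fixes A :: "'a::{boolean_group, finite} set"
  assumes sum_free: "sum_free (unique_sums A)"
    and no_isolated: "Domain (unique_sum_graph A) = A"
    and ab: "(a, b) \<in> unique_sum_graph A" and cd: "(c, d) \<in> unique_sum_graph A"
    and disjoint: "{a, b} \<inter> {c, d} = {}"
  shows "3 * card A \<le> CARD('a) + 6"
proof -
  let ?missing = "\<lambda>P. Restr (unique_sum_graph A) (- P)"
  have few_missing: "card (?missing {x, y}) + 2 * card A \<le> CARD('a) + 2"
    if "(x, y) \<in> unique_sum_graph A" for x y
    using card_le_two_card_edge_sums[of "?missing {x, y}" A]
      card_edge_sums_missing_edge[OF sum_free that] by simp
  have "{a, b} \<subseteq> A" "{c, d} \<subseteq> A"
    using unique_sum_graphD(1,2) ab cd by blast+
  then have "2 * card A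
      \<le> card (?missing {a, b}) + card (?missing {c, d}) + 2 * card {a, b} + 2 * card {c, d}"
    using card_Domain_le_card_Restr[OF _ sym_unique_sum_graph] no_isolated disjoint
    by (metis finite)
  moreover have "card {a, b} = 2" "card {c, d} = 2"
    using unique_sum_graphD(3)[OF ab] unique_sum_graphD(3)[OF cd] by simp_all
  ultimately show ?thesis
    using few_missing[OF ab] few_missing[OF cd] by linarith
qed

lemma Domain_unique_sum_graph_round_set:
  fixes A :: "'a::boolean_group set"
  assumes "round_set A" "\<not> is_singleton A"
  shows "Domain (unique_sum_graph A) = A"
proof
  show "Domain (unique_sum_graph A) \<subseteq> A"
    by (auto dest: unique_sum_graphD(1))
  show "A \<subseteq> Domain (unique_sum_graph A)"
  proof
    fix a
    assume "a \<in> A"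
    define B where "B = A - {a}"
    obtain c where "c \<in> B"
      using \<open>a \<in> A\<close> assms(2) by (auto simp: B_def is_singleton_def)
    then have "0 \<in> B + B"
      using set_plus_intro[of c B c B] by simp
    have "B \<subset> A"
      using \<open>a \<in> A\<close> by (auto simp: B_def)
    then have "B + B \<noteq> A + A" "B + B \<subseteq> A + A"
      using assms(1) by (simp_all add: round_set_def set_plus_mono2 less_imp_le)
    then obtain s where "s \<in> A + A" and "s \<notin> B + B"
      by blast
    then have uses_a: "x = a \<or> y = a" if "x \<in> A" "y \<in> A" "x + y = s" for x y
      using that by (auto simp: B_def)
    obtain b where b: "b \<in> A" "s = a + b"
      using \<open>s \<in> A + A\<close> uses_a by (metis add.commute set_plus_elim)
    moreover have "a \<noteq> b"
      using \<open>0 \<in> B + B\<close> \<open>s \<notin> B + B\<close> b(2) by auto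
    moreover have "{x, y} = {a, b}" if "x \<in> A" "y \<in> A" "x + y = a + b" for x y
      using uses_a[of x y] that b by (auto simp: add.commute)
    ultimately have "(a, b) \<in> unique_sum_graph A"
      using \<open>a \<in> A\<close> unfolding unique_sum_graph_def by blast
    then show "a \<in> Domain (unique_sum_graph A)"
      by blast
  qed
qed

lemma sum_free_translate_minus_zero:
  fixes A :: "'a::boolean_group set"
  assumes "A - {g} \<subseteq> unique_sum_graph A `` {g}"
  shows "sum_free ((g +o A) - {0})"
proof (rule sum_freeI, rule notI)
  fix s t
  assume "s \<in> (g +o A) - {0}" "t \<in> (g +o A) - {0}" "s + t \<in> (g +o A) - {0}"
  then have A: "g + s \<in> A" "g + t \<in> A" "g + (s + t) \<in> A"
    and nonzero: "s \<noteq> 0" "t \<noteq> 0" "s + t \<noteq> 0"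
    by (simp_all add: mem_translate_iff)
  have "(g, g + (s + t)) \<in> unique_sum_graph A"
    using assms A(3) nonzero(3) by (simp add: subset_iff)
  moreover have "(g + s) + (g + t) = g + (g + (s + t))"
    by (simp add: ac_simps)
  ultimately have "{g + s, g + t} = {g, g + (s + t)}"
    using A(1,2) by (intro unique_sum_graphD(4))
  with nonzero(1,2) show False
    by (auto simp: doubleton_eq_iff)
qed

theorem large_round_set:
  fixes A :: "'a::{boolean_group, finite} set"
  assumes "round_set A" and large: "3 * card A > CARD('a) + 6"
  shows "\<exists>S g. sum_free S \<and> A = g +o (S \<union> {0})"
proof -
  have no_isolated: "Domain (unique_sum_graph A) = A"
    using assms by (intro Domain_unique_sum_graph_round_set) (auto simp: is_singleton_altdef)
  have meet: "{a, b} \<inter> {c, d} \<noteq> {}"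
    if "(a, b) \<in> unique_sum_graph A" "(c, d) \<in> unique_sum_graph A" for a b c d
    using card_le_if_disjoint_edges[OF sum_free_unique_sums[OF large] no_isolated that] large
    by auto
  have "unique_sum_graph A \<noteq> {}"
    using no_isolated large by auto
  then obtain g where g: "g \<in> A" "A - {g} \<subseteq> unique_sum_graph A `` {g}"
    using ex_dominating_vertex[OF sym_unique_sum_graph] meet no_isolated by metis
  have "sum_free ((g +o A) - {0})"
    using g(2) by (rule sum_free_translate_minus_zero)
  moreover have "0 \<in> g +o A"
    using g(1) by (simp add: mem_translate_iff)
  then have "A = g +o ((g +o A) - {0} \<union> {0})"
    by (simp add: insert_absorb set_plus_rearrange2)
  ultimately show ?thesis
    by blast
qed


subsection \<open>The group of binary vectors\<close>

lemma UNIV_bit: "(UNIV :: bit set) = {0, 1}"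
  by auto

instance bit :: finite
  by standard (simp add: UNIV_bit)

instance bit :: boolean_group
  by standard simp

instance vec :: (boolean_group, finite) boolean_group
  by standard (simp add: vec_eq_iff)

lemma CARD_bit_vec: "CARD(bit ^ 'n::finite) = 2 ^ CARD('n)"
proof -
  have "CARD(bit) = 2"
    by (simp add: UNIV_bit)
  then show ?thesis
    by simp
qed

theorem theorem3p3:
  fixes A :: "(bit ^ 'n::finite) set"
  assumes "round_set A"
    and "real (card A) > 1 / 3 * 2 ^ CARD('n) + 2"
  shows "\<exists>(S :: (bit ^ 'n) set) (g :: bit ^ 'n). sum_free S \<and> A = g +o (S \<union> {0})"
proof (rule large_round_set[OF assms(1)])
  have "real (3 * card A) > real (2 ^ CARD('n) + 6)"
    using assms(2) by simp
  then show "3 * card A > CARD(bit ^ 'n) + 6"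
    unfolding CARD_bit_vec by linarith
qed

end
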